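(* For any non-empty index $\mathbf{k}=(k_1,\ldots,k_r)$ of positive integers, any $n\ge1$ and any primitive $n$-th root of unity $\zeta_n$, $$z_n^\star(\mathbf{k};\zeta_n)=(-1)^{\mathrm{wt}(\mathbf{k})+1}\,z_n^\star\big(\overline{\mathbf{k}^\vee};\zeta_n\big).$$
   Context: The weight is $\mathrm{wt}(k_1,\dots,k_r)=k_1+\cdots+k_r$. For $n\ge1$ and $q\in\mathbb{C}$ with $q^m\ne1$ for $0<m<n$, set $[m]_q=\frac{1-q^m}{1-q}$ and $$z_n^\star(k_1,\ldots,k_r;q)=\sum_{n>m_1\ge\cdots\ge m_r>0}\prod_{j=1}^r\frac{q^{(k_j-1)m_j}}{[m_j]_q^{k_j}}$$ (empty sum is $0$). The reverse of $\mathbf{k}=(k_1,\ldots,k_r)$ is $\overline{\mathbf{k}}=(k_r,\ldots,k_1)$. The Hoffman dual $\mathbf{k}^\vee$ of a non-empty index is defined as follows. Let $\mathfrak{H}=\mathbb{Q}\langle e_0,e_1\rangle$ be the noncommutative polynomial algebra, put $e_k=e_0^{k-1}e_1$ for $k\ge1$ and $e_{\mathbf{k}}=e_{k_1}\cdots e_{k_r}$, and let $\tau$ be the algebra automorphism of $\mathfrak{H}$ exchanging $e_0$ and $e_1$. Write $e_{\mathbf{k}}=w'e_1$ with $w'$ a word in $e_0,e_1$; then $\mathbf{k}^\vee$ is the index with $e_{\mathbf{k}^\vee}=\tau(w')e_1$. For example $(3,2)^\vee=(1,1,2,1)$. *)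

theory Defs
  imports Complex_Main
begin

definition q_number :: "complex \<Rightarrow> nat \<Rightarrow> complex" where
  "q_number q m = (1 - q ^ m) / (1 - q)"

text \<open>
  The chains \<open>n > m\<^sub>1 \<ge> \<dots> \<ge> m\<^sub>r > 0\<close>, as lists \<open>[m\<^sub>1, \<dots>, m\<^sub>r]\<close>.
\<close>

definition star_chains :: "nat \<Rightarrow> nat \<Rightarrow> nat list set" where
  "star_chains n r = {ms. length ms = r \<and> sorted_wrt (\<ge>) ms \<and> (\<forall>m\<in>set ms. 0 < m \<and> m < n)}"

lemma finite_star_chains: "finite (star_chains n r)"
proof (rule finite_subset)
  show "star_chains n r \<subseteq> {ms. set ms \<subseteq> {..<n} \<and> length ms = r}"
    by (auto simp: star_chains_def)
  show "finite {ms. set ms \<subseteq> {..<n} \<and> length ms = r}"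
    by (rule finite_lists_length_eq) simp
qed

text \<open>
  Only meaningful if \<open>q ^ m \<noteq> 1\<close> for \<open>0 < m < n\<close> and all entries of the index are positive
  (the exponent \<open>k\<^sub>j - 1\<close> is a truncated subtraction). Entries are counted from 0 by \<open>!\<close>.
\<close>

definition z_star :: "nat \<Rightarrow> nat list \<Rightarrow> complex \<Rightarrow> complex" where
  "z_star n ks q =
    (\<Sum>ms\<in>star_chains n (length ks).
      \<Prod>j<length ks. q ^ ((ks ! j - 1) * ms ! j) / q_number q (ms ! j) ^ (ks ! j))"

definition primitive_root_of_unity :: "nat \<Rightarrow> complex \<Rightarrow> bool" where
  "primitive_root_of_unity n \<zeta> \<longleftrightarrow> n \<ge> 1 \<and> \<zeta> ^ n = 1 \<and> (\<forall>m. 0 < m \<and> m < n \<longrightarrow> \<zeta> ^ m \<noteq> 1)"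

definition is_index :: "nat list \<Rightarrow> bool" where
  "is_index ks \<longleftrightarrow> (\<forall>k\<in>set ks. k \<ge> 1)"

abbreviation wt :: "nat list \<Rightarrow> nat" where
  "wt ks \<equiv> sum_list ks"

text \<open>
  The Hoffman dual only involves monomials of the noncommutative polynomial algebra in
  \<open>e\<^sub>0\<close> and \<open>e\<^sub>1\<close>. These are lists of letters; multiplication is concatenation, and the
  automorphism exchanging \<open>e\<^sub>0\<close> and \<open>e\<^sub>1\<close> acts on them letter by letter.
\<close>

datatype letter = E0 | E1

fun swap_letter :: "letter \<Rightarrow> letter" where
  "swap_letter E0 = E1"
| "swap_letter E1 = E0"

definition tau :: "letter list \<Rightarrow> letter list" where
  "tau w = map swap_letter w"

definition index_word :: "nat list \<Rightarrow> letter list" where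
  "index_word ks = concat (map (\<lambda>k. replicate (k - 1) E0 @ [E1]) ks)"

definition hoffman_dual :: "nat list \<Rightarrow> nat list" where
  "hoffman_dual ks =
    (THE ls. is_index ls \<and> (\<exists>w. index_word ks = w @ [E1] \<and> index_word ls = tau w @ [E1]))"

lemma index_word_Nil [simp]: "index_word [] = []"
  by (simp add: index_word_def)

lemma index_word_Cons [simp]:
  "index_word (k # ks) = replicate (k - 1) E0 @ E1 # index_word ks"
  by (simp add: index_word_def)

lemma is_index_Nil [simp]: "is_index []"
  by (simp add: is_index_def)

lemma is_index_Cons [simp]: "is_index (k # ks) \<longleftrightarrow> k \<ge> 1 \<and> is_index ks"
  by (simp add: is_index_def)

lemma replicate_E0_E1_inject:
  "replicate a E0 @ E1 # u = replicate b E0 @ E1 # v \<longleftrightarrow> a = b \<and> u = v"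
proof (induction a arbitrary: b)
  case 0
  then show ?case by (cases b) auto
next
  case (Suc a)
  then show ?case by (cases b) auto
qed

lemma index_word_inject:
  assumes "is_index ks" "is_index ls" "index_word ks = index_word ls"
  shows "ks = ls"
  using assms
proof (induction ks arbitrary: ls)
  case Nil
  then show ?case by (cases ls) auto
next
  case (Cons k ks)
  then obtain l ls' where ls: "ls = l # ls'" by (cases ls) auto
  show ?case
    using Cons.prems Cons.IH[of ls'] by (auto simp: ls replicate_E0_E1_inject)
qed

lemma index_word_surj: "\<exists>ls. is_index ls \<and> index_word ls = w @ [E1]"
proof (induction w)
  case Nil
  have "is_index [1] \<and> index_word [1] = [] @ [E1]" by simp
  then show ?case by blast
next
  case (Cons x w)
  then obtain ls where ls: "is_index ls" "index_word ls = w @ [E1]" by blast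
  show ?case
  proof (cases x)
    case E1
    have "is_index (1 # ls) \<and> index_word (1 # ls) = (x # w) @ [E1]" by (simp add: ls E1)
    then show ?thesis by blast
  next
    case E0
    from ls obtain l ls' where l: "ls = l # ls'" by (cases ls) auto
    with ls have "l \<ge> 1" by simp
    then have "replicate l E0 = E0 # replicate (l - 1) E0"
      by (cases l) auto
    then have "is_index (Suc l # ls') \<and> index_word (Suc l # ls') = (x # w) @ [E1]"
      using ls by (simp add: l E0)
    then show ?thesis by blast
  qed
qed

lemma index_word_last:
  assumes "ks \<noteq> []"
  shows "\<exists>w. index_word ks = w @ [E1]"
proof -
  from assms obtain ks' k where "ks = ks' @ [k]" by (cases ks rule: rev_cases) auto
  then show ?thesis by (simp add: index_word_def)
qed

lemma hoffman_dual_unique: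
  assumes "is_index ls" "index_word ks = w @ [E1]" "index_word ls = tau w @ [E1]"
  shows "hoffman_dual ks = ls"
  unfolding hoffman_dual_def
  using assms by (intro the_equality) (auto intro: index_word_inject)

lemma hoffman_dual_exists:
  assumes "ks \<noteq> []"
  shows "is_index (hoffman_dual ks) \<and>
    (\<exists>w. index_word ks = w @ [E1] \<and> index_word (hoffman_dual ks) = tau w @ [E1])"
proof -
  obtain w where w: "index_word ks = w @ [E1]"
    using index_word_last[OF assms] by blast
  obtain ls where ls: "is_index ls" "index_word ls = tau w @ [E1]"
    using index_word_surj by blast
  show ?thesis
    using hoffman_dual_unique[OF ls(1) w ls(2)] w ls by auto
qed

lemma hoffman_dual_example: "hoffman_dual [3, 2] = [1, 1, 2, 1]"
  by (rule hoffman_dual_unique[where w = "[E0, E0, E1, E0]"])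
    (simp_all add: tau_def numeral_eq_Suc)

end

theory Submission
  imports Defs
begin

text \<open>
  Up to the common factor \<open>(1 - q) ^ wt\<close>, the letter \<open>e\<^sub>0\<close> carries the weight
  \<open>a\<^sub>m = q\<^sup>m / (1 - q\<^sup>m)\<close> and the letter \<open>e\<^sub>1\<close> the weight \<open>b\<^sub>m = 1 / (1 - q\<^sup>m)\<close>. Reading a word
  letter by letter, \<open>e\<^sub>0\<close> acts on functions of \<open>m\<close> as multiplication by \<open>a\<close>, and \<open>e\<^sub>1\<close> as \<open>b S\<close>,
  where \<open>(S f) m = f 1 + \<dots> + f m\<close>. Duality combines two symmetries of these weights.

  The reflection \<open>m \<mapsto> n - m\<close> reverses the order of the chains and sends \<open>a\<close> to \<open>- b\<close> and \<open>b\<close> to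
  \<open>- a\<close> when \<open>q\<^sup>n = 1\<close>. It accounts for the reversal and for the sign \<open>(-1) ^ wt\<close>
  (\<open>star_sum_reflect\<close>). What remains to be shown is that exchanging the two letters of the word
  and the two weights at the same time only changes the sign of the sum.

  The \<open>q\<close>-binomial transform \<open>K\<close> does this. It turns multiplication by \<open>a\<close> into \<open>a S\<close>, and
  \<open>b S\<close> into multiplication by \<open>b\<close>, as soon as the weights are defined, that is, \<open>q\<^sup>j \<noteq> 1\<close> for
  \<open>0 < j < n\<close> (\<open>transform_mult_weight0\<close> and \<open>transform_weight1_sum\<close>); both
  identities come from the \<open>q\<close>-Pascal rules. As also \<open>K b = - a\<close>, it maps the function of a
  word to minus the function of the dual word
  (\<open>transform_word_fun\<close>). At a primitive \<open>n\<close>-th root of unity, \<open>K\<close> preserves the total sum over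
  \<open>0 < m < n\<close>, because the Gaussian binomials with upper index \<open>n - 1\<close> degenerate to signed powers
  of \<open>q\<close> (\<open>sum_transform_kernel_root\<close>).
\<close>

section \<open>Star sums with arbitrary weights\<close>

definition star_sum :: "nat \<Rightarrow> (nat \<Rightarrow> complex) list \<Rightarrow> complex" where
  "star_sum n gs = (\<Sum>ms\<in>star_chains n (length gs). \<Prod>j<length gs. (gs ! j) (ms ! j))"

lemma star_sum_Nil [simp]: "star_sum n [] = 1"
proof -
  have "star_chains n 0 = {[]}"
    by (auto simp: star_chains_def)
  then show ?thesis
    by (simp add: star_sum_def)
qed

lemma star_chains_Suc:
  "star_chains n (Suc r) = (\<lambda>(m, ms). m # ms) ` (SIGMA m:{0<..<n}. star_chains (Suc m) r)"
proof (intro equalityI subsetI)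
  fix ms
  assume "ms \<in> star_chains n (Suc r)"
  then show "ms \<in> (\<lambda>(m, ms). m # ms) ` (SIGMA m:{0<..<n}. star_chains (Suc m) r)"
    by (cases ms) (auto simp: star_chains_def less_Suc_eq_le)
next
  fix ms
  assume "ms \<in> (\<lambda>(m, ms). m # ms) ` (SIGMA m:{0<..<n}. star_chains (Suc m) r)"
  then show "ms \<in> star_chains n (Suc r)"
    by (fastforce simp: star_chains_def less_Suc_eq_le)
qed

lemma star_sum_Cons: "star_sum n (g # gs) = (\<Sum>m\<in>{0<..<n}. g m * star_sum (Suc m) gs)"
proof -
  have inj: "inj_on (\<lambda>(m, ms). m # ms) (SIGMA m:{0<..<n}. star_chains (Suc m) (length gs))"
    by (auto simp: inj_on_def)
  have "star_sum n (g # gs) = (\<Sum>(m, ms)\<in>(SIGMA m:{0<..<n}. star_chains (Suc m) (length gs)).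
      g m * (\<Prod>j<length gs. (gs ! j) (ms ! j)))"
    unfolding star_sum_def list.size(4) add_Suc_right add_0_right star_chains_Suc
      sum.reindex[OF inj]
    by (simp add: prod.lessThan_Suc_shift case_prod_unfold del: prod.lessThan_Suc)
  also have "\<dots> = (\<Sum>m\<in>{0<..<n}. \<Sum>ms\<in>star_chains (Suc m) (length gs).
      g m * (\<Prod>j<length gs. (gs ! j) (ms ! j)))"
    by (rule sum.Sigma[symmetric]) (auto simp: finite_star_chains)
  finally show ?thesis
    by (simp add: star_sum_def sum_distrib_left)
qed

lemma star_sum_cong:
  assumes "list_all2 (\<lambda>g h. \<forall>m\<in>{0<..<n}. g m = h m) gs hs"
  shows "star_sum n gs = star_sum n hs"
proof -
  have len: "length gs = length hs"
    using assms by (rule list_all2_lengthD)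
  show ?thesis
    unfolding star_sum_def len
  proof (intro sum.cong prod.cong refl)
    fix ms j
    assume "ms \<in> star_chains n (length hs)" "j \<in> {..<length hs}"
    then have "j < length hs" "ms ! j \<in> {0<..<n}"
      by (auto simp: star_chains_def)
    then show "(gs ! j) (ms ! j) = (hs ! j) (ms ! j)"
      using assms len by (auto simp: list_all2_conv_all_nth)
  qed
qed

lemma star_sum_scale:
  "star_sum n (map (\<lambda>k m. c ^ k * g k m) ks) = c ^ sum_list ks * star_sum n (map g ks)"
  by (induction ks arbitrary: n)
    (simp_all add: star_sum_Cons sum_distrib_left power_add mult_ac)

lemma star_chains_reflect:
  assumes "ms \<in> star_chains n r"
  shows "rev (map (\<lambda>m. n - m) ms) \<in> star_chains n r"
  using assms
  by (auto simp: star_chains_def sorted_wrt_rev sorted_wrt_map diff_le_mono2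
      elim!: sorted_wrt_mono_rel[rotated])

lemma star_sum_reflect: "star_sum n gs = star_sum n (rev (map (\<lambda>g m. g (n - m)) gs))"
proof -
  let ?r = "length gs"
  let ?refl = "\<lambda>ms. rev (map (\<lambda>m. n - m) ms)"
  have inv: "?refl (?refl ms) = ms" if "ms \<in> star_chains n ?r" for ms
    using that by (auto simp: star_chains_def rev_map[symmetric] intro!: map_idI)
  show ?thesis
    unfolding star_sum_def length_rev length_map
  proof (rule sum.reindex_bij_witness[where i = ?refl and j = ?refl])
    fix ms
    assume ms: "ms \<in> star_chains n ?r"
    then have len: "length ms = ?r"
      by (simp add: star_chains_def)
    have "(\<Prod>j<?r. (rev (map (\<lambda>g m. g (n - m)) gs) ! j) (?refl ms ! j))
        = (\<Prod>j<?r. (gs ! (?r - Suc j)) (ms ! (?r - Suc j)))"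
    proof (intro prod.cong refl)
      fix j
      assume "j \<in> {..<?r}"
      then have j: "j < ?r" and "ms ! (?r - Suc j) \<in> set ms"
        using len by auto
      then have "ms ! (?r - Suc j) < n"
        using ms by (auto simp: star_chains_def)
      then show "(rev (map (\<lambda>g m. g (n - m)) gs) ! j) (?refl ms ! j)
          = (gs ! (?r - Suc j)) (ms ! (?r - Suc j))"
        using j len by (simp add: rev_nth)
    qed
    also have "\<dots> = (\<Prod>j<?r. (gs ! j) (ms ! j))"
      by (rule prod.nat_diff_reindex)
    finally show "(\<Prod>j<?r. (rev (map (\<lambda>g m. g (n - m)) gs) ! j) (?refl ms ! j))
        = (\<Prod>j<?r. (gs ! j) (ms ! j))" .
  qed (use inv star_chains_reflect in auto)
qed

section \<open>Star sums of words\<close>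

text \<open>
  The summand of the star sum of the word \<open>w e\<^sub>1\<close> as a function of its outermost variable: the
  weight of \<open>e\<^sub>0\<close> is \<open>x\<close>, that of \<open>e\<^sub>1\<close> is \<open>y\<close>, and only \<open>e\<^sub>1\<close> opens a new summation. Removing
  the last letter is what makes Hoffman duality a letter by letter exchange.
\<close>

primrec word_fun :: "(nat \<Rightarrow> complex) \<Rightarrow> (nat \<Rightarrow> complex) \<Rightarrow> letter list \<Rightarrow> nat \<Rightarrow> complex" where
  "word_fun x y [] m = y m"
| "word_fun x y (e # w) m = (case e of
      E0 \<Rightarrow> x m * word_fun x y w m
    | E1 \<Rightarrow> y m * (\<Sum>i\<in>{0<..<Suc m}. word_fun x y w i))"

lemma word_fun_replicate:
  "word_fun x y (replicate j E0 @ w) m = x m ^ j * word_fun x y w m"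
  by (induction j) simp_all

lemma star_sum_index_word:
  assumes "ks \<noteq> []" "index_word ks = w @ [E1]"
  shows "star_sum n (map (\<lambda>k m. x m ^ (k - 1) * y m) ks) = (\<Sum>m\<in>{0<..<n}. word_fun x y w m)"
  using assms
proof (induction ks arbitrary: w n)
  case Nil
  then show ?case by simp
next
  case (Cons k ks)
  show ?case
  proof (cases "ks = []")
    case True
    with Cons.prems have "w = replicate (k - 1) E0 @ []"
      by simp
    then show ?thesis
      by (simp only: word_fun_replicate) (simp add: True star_sum_Cons)
  next
    case False
    then obtain v where v: "index_word ks = v @ [E1]"
      using index_word_last by blast
    with Cons.prems have "w = replicate (k - 1) E0 @ E1 # v"
      by simp
    then show ?thesis
      by (simp add: word_fun_replicate star_sum_Cons Cons.IH[OF False v] mult.assoc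
          del: One_nat_def)
  qed
qed

lemma length_index_word: "is_index ks \<Longrightarrow> length (index_word ks) = wt ks"
  by (induction ks) auto

section \<open>The weights of the two letters\<close>

definition weight0 :: "complex \<Rightarrow> nat \<Rightarrow> complex" where
  "weight0 q m = q ^ m / (1 - q ^ m)"

definition weight1 :: "complex \<Rightarrow> nat \<Rightarrow> complex" where
  "weight1 q m = 1 / (1 - q ^ m)"

lemma z_star_eq_star_sum:
  assumes "is_index ks"
  shows "z_star n ks q =
    (1 - q) ^ wt ks * star_sum n (map (\<lambda>k m. weight0 q m ^ (k - 1) * weight1 q m) ks)"
proof -
  have factor: "q ^ ((k - 1) * m) / q_number q m ^ k =
      (1 - q) ^ k * (weight0 q m ^ (k - 1) * weight1 q m)" if k: "k \<ge> 1" for k m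
  proof -
    obtain j where "k = Suc j"
      using k by (cases k) simp_all
    moreover have "q ^ (j * m) = (q ^ m) ^ j"
      by (simp add: power_mult[symmetric] mult.commute)
    ultimately show ?thesis
      by (simp add: q_number_def weight0_def weight1_def power_divide mult_ac)
  qed
  have "z_star n ks q = star_sum n (map (\<lambda>k m. q ^ ((k - 1) * m) / q_number q m ^ k) ks)"
    by (simp add: z_star_def star_sum_def)
  also have "\<dots> =
      star_sum n (map (\<lambda>k m. (1 - q) ^ k * (weight0 q m ^ (k - 1) * weight1 q m)) ks)"
    using assms
    by (intro star_sum_cong)
      (auto simp: list_all2_conv_all_nth factor is_index_def simp del: One_nat_def)
  finally show ?thesis
    by (simp add: star_sum_scale)
qed

lemma weight_reflect:
  assumes "q ^ n = 1" "m \<le> n"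
  shows "weight0 q (n - m) = - weight1 q m" "weight1 q (n - m) = - weight0 q m"
proof -
  have *: "q ^ (n - m) * q ^ m = 1"
    using assms by (simp add: power_add[symmetric])
  then have nz: "q ^ m \<noteq> 0"
    by (metis mult_zero_right zero_neq_one)
  with * have inv: "q ^ (n - m) = 1 / q ^ m"
    by (simp add: eq_divide_eq)
  show "weight0 q (n - m) = - weight1 q m" "weight1 q (n - m) = - weight0 q m"
    using nz by (cases "q ^ m = 1"; simp add: weight0_def weight1_def inv field_simps)+
qed

section \<open>Gaussian binomial coefficients\<close>

fun gauss_binomial :: "complex \<Rightarrow> nat \<Rightarrow> nat \<Rightarrow> complex" where
  "gauss_binomial q m 0 = 1"
| "gauss_binomial q 0 (Suc p) = 0"
| "gauss_binomial q (Suc m) (Suc p) = gauss_binomial q m p + q ^ Suc p * gauss_binomial q m (Suc p)"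

lemma gauss_binomial_eq_0: "m < p \<Longrightarrow> gauss_binomial q m p = 0"
  by (induction q m p rule: gauss_binomial.induct) auto

lemma gauss_binomial_absorb:
  "(1 - q ^ Suc p) * gauss_binomial q (Suc m) (Suc p) = (1 - q ^ Suc m) * gauss_binomial q m p"
proof (induction m arbitrary: p)
  case 0
  then show ?case by (cases p) auto
next
  case (Suc m)
  note IH = Suc.IH
  have *: "(q ^ p - q ^ Suc m) * gauss_binomial q (Suc m) p =
      q ^ p * ((1 - q ^ Suc m) * gauss_binomial q m p)"
  proof (cases p)
    case (Suc r)
    have "(q ^ p - q ^ Suc m) * gauss_binomial q (Suc m) p =
        (1 - q ^ Suc m) * gauss_binomial q (Suc m) p - (1 - q ^ p) * gauss_binomial q (Suc m) p"
      by (simp add: algebra_simps)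
    also have "(1 - q ^ p) * gauss_binomial q (Suc m) p = (1 - q ^ Suc m) * gauss_binomial q m r"
      using IH[of r] Suc by simp
    finally show ?thesis
      by (simp add: Suc algebra_simps)
  qed simp
  have "(1 - q ^ Suc p) * gauss_binomial q (Suc (Suc m)) (Suc p) =
      (1 - q ^ Suc p) * gauss_binomial q (Suc m) p
      + q ^ Suc p * ((1 - q ^ Suc p) * gauss_binomial q (Suc m) (Suc p))"
    by (simp only: gauss_binomial.simps) (simp add: algebra_simps)
  also have "\<dots> = (1 - q ^ Suc p) * gauss_binomial q (Suc m) p
      + q * (q ^ p * ((1 - q ^ Suc m) * gauss_binomial q m p))"
    by (simp only: IH) simp
  also have "\<dots> = (1 - q ^ Suc p) * gauss_binomial q (Suc m) p
      + q * ((q ^ p - q ^ Suc m) * gauss_binomial q (Suc m) p)"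
    by (simp only: *)
  finally show ?case
    by (simp add: algebra_simps del: gauss_binomial.simps)
qed

text \<open>The second Pascal rule, multiplied by \<open>q\<^sup>p\<^sup>+\<^sup>1\<close> to keep the exponents free of subtraction.\<close>

lemma gauss_binomial_Pascal2:
  "q ^ Suc p * gauss_binomial q (Suc m) (Suc p) =
    q ^ Suc m * gauss_binomial q m p + q ^ Suc p * gauss_binomial q m (Suc p)"
  using gauss_binomial_absorb[of q p m] by (simp add: algebra_simps)

section \<open>The q-binomial transform\<close>

text \<open>The signed power \<open>(-1)\<^sup>p q ^ (p choose 2)\<close> of the \<open>q\<close>-binomial theorem.\<close>

definition signed_power :: "complex \<Rightarrow> nat \<Rightarrow> complex" where
  "signed_power q p = (\<Prod>i<p. - (q ^ i))"

lemma signed_power_simps [simp]: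
  "signed_power q 0 = 1"
  "signed_power q (Suc p) = - (q ^ p) * signed_power q p"
  by (simp_all add: signed_power_def)

text \<open>
  When the values of \<open>weight0\<close> are distinct, the condition that the transform turns multiplication
  by \<open>weight0\<close> into \<open>weight0\<close> times summation determines each column \<open>p\<close> up to a
  factor; the factor is chosen so that all columns sum to 1 at a root of unity.
\<close>

definition transform_kernel :: "complex \<Rightarrow> nat \<Rightarrow> nat \<Rightarrow> complex" where
  "transform_kernel q m p = q ^ m * signed_power q p * gauss_binomial q (m - 1) (p - 1)"

lemma sum_transform_kernel_column:
  assumes "p > 0"
  shows "(\<Sum>m\<in>{0<..<Suc M}. transform_kernel q m p) =
    q ^ p * signed_power q p * gauss_binomial q M p"
proof -
  obtain r where r: "p = Suc r"
    using assms by (cases p) auto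
  show ?thesis
  proof (induction M)
    case 0
    have "{0<..<Suc 0} = {}"
      by auto
    then show ?case
      by (simp add: r)
  next
    case (Suc M)
    have "{0<..<Suc (Suc M)} = insert (Suc M) {0<..<Suc M}"
      by auto
    then have "(\<Sum>m\<in>{0<..<Suc (Suc M)}. transform_kernel q m p) =
        transform_kernel q (Suc M) p + q ^ p * signed_power q p * gauss_binomial q M p"
      using Suc.IH by simp
    also have "\<dots> = signed_power q p *
        (q ^ Suc M * gauss_binomial q M r + q ^ Suc r * gauss_binomial q M (Suc r))"
      by (simp add: transform_kernel_def r algebra_simps)
    also have "\<dots> = signed_power q p * (q ^ Suc r * gauss_binomial q (Suc M) (Suc r))"
      by (simp only: gauss_binomial_Pascal2)
    finally show ?case
      by (simp only: r mult_ac)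
  qed
qed

text \<open>The summand telescopes by the first Pascal rule.\<close>

lemma sum_signed_power_gauss_binomial:
  assumes "i \<le> n" "M < n"
  shows "(\<Sum>p=i..<n. signed_power q (Suc p) * gauss_binomial q (Suc M) (Suc p)) =
    signed_power q (Suc i) * gauss_binomial q M i"
proof -
  have "(\<Sum>p=i..<n. signed_power q (Suc p) * gauss_binomial q (Suc M) (Suc p)) =
      (\<Sum>p=i..<n. - (signed_power q (Suc (Suc p)) * gauss_binomial q M (Suc p))
        - - (signed_power q (Suc p) * gauss_binomial q M p))"
    by (intro sum.cong) (simp_all add: algebra_simps)
  also have "\<dots> = - (signed_power q (Suc n) * gauss_binomial q M n)
      - - (signed_power q (Suc i) * gauss_binomial q M i)"
    by (rule sum_Suc_diff') (fact assms(1))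
  finally show ?thesis
    using assms(2) by (simp add: gauss_binomial_eq_0)
qed

lemma gauss_binomial_weight1:
  assumes "0 < p" "0 < m" "q ^ p \<noteq> 1" "q ^ m \<noteq> 1"
  shows "gauss_binomial q (m - 1) (p - 1) * weight1 q p = weight1 q m * gauss_binomial q m p"
proof -
  obtain r M where rM: "p = Suc r" "m = Suc M"
    using assms by (cases p; cases m) auto
  show ?thesis
    using gauss_binomial_absorb[of q r M] assms(3,4) unfolding rM weight1_def
    by (simp add: field_simps del: gauss_binomial.simps power_Suc)
qed

lemma sum_transform_kernel_row:
  assumes "0 < i" "i < n" "0 < m" "m < n" and q: "\<And>j. 0 < j \<Longrightarrow> j < n \<Longrightarrow> q ^ j \<noteq> 1"
  shows "(\<Sum>p=i..<n. transform_kernel q m p * weight1 q p) = weight1 q m * transform_kernel q m i"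
proof -
  obtain r M N where r: "i = Suc r" "m = Suc M" "n = Suc N"
    using assms by (cases i; cases m; cases n) auto
  have "(\<Sum>p=i..<n. transform_kernel q m p * weight1 q p) =
      (\<Sum>p=i..<n. weight1 q m * q ^ m * (signed_power q p * gauss_binomial q m p))"
  proof (intro sum.cong refl)
    fix p
    assume "p \<in> {i..<n}"
    then have "gauss_binomial q (m - 1) (p - 1) * weight1 q p = weight1 q m * gauss_binomial q m p"
      using assms by (intro gauss_binomial_weight1) auto
    then show "transform_kernel q m p * weight1 q p =
        weight1 q m * q ^ m * (signed_power q p * gauss_binomial q m p)"
      by (simp add: transform_kernel_def mult_ac)
  qed
  also have "\<dots> = weight1 q m * q ^ m *
      (\<Sum>p=r..<N. signed_power q (Suc p) * gauss_binomial q (Suc M) (Suc p))"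
    unfolding r sum.shift_bounds_Suc_ivl sum_distrib_left ..
  also have "\<dots> = weight1 q m * q ^ m * (signed_power q (Suc r) * gauss_binomial q M r)"
    using assms r by (subst sum_signed_power_gauss_binomial) auto
  finally show ?thesis
    by (simp add: transform_kernel_def r mult_ac del: signed_power_simps)
qed

text \<open>
  The kernel vanishes for \<open>p > m\<close>, so that the bound \<open>n\<close> is immaterial for \<open>m < n\<close>; a bound
  independent of \<open>m\<close> lets sums be exchanged over rectangles.
\<close>

definition transform :: "complex \<Rightarrow> nat \<Rightarrow> (nat \<Rightarrow> complex) \<Rightarrow> nat \<Rightarrow> complex" where
  "transform q n f m = (\<Sum>p\<in>{0<..<n}. transform_kernel q m p * f p)"

lemma transform_mult_weight0:
  assumes "0 < m" "m < n" and q: "\<And>j. 0 < j \<Longrightarrow> j < n \<Longrightarrow> q ^ j \<noteq> 1"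
  shows "transform q n (\<lambda>p. weight0 q p * f p) m =
    weight0 q m * (\<Sum>i\<in>{0<..<Suc m}. transform q n f i)"
proof -
  have "(\<Sum>i\<in>{0<..<Suc m}. transform q n f i) =
      (\<Sum>p\<in>{0<..<n}. (\<Sum>i\<in>{0<..<Suc m}. transform_kernel q i p) * f p)"
    unfolding transform_def sum_distrib_right by (rule sum.swap)
  also have "weight0 q m * \<dots> =
      (\<Sum>p\<in>{0<..<n}. transform_kernel q m p * (weight0 q p * f p))"
    unfolding sum_distrib_left
  proof (intro sum.cong refl)
    fix p
    assume p: "p \<in> {0<..<n}"
    then have "gauss_binomial q (m - 1) (p - 1) * weight1 q p = weight1 q m * gauss_binomial q m p"
      using assms by (intro gauss_binomial_weight1) auto
    moreover have "weight0 q j = q ^ j * weight1 q j" for j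
      by (simp add: weight0_def weight1_def)
    ultimately show "weight0 q m * ((\<Sum>i\<in>{0<..<Suc m}. transform_kernel q i p) * f p) =
        transform_kernel q m p * (weight0 q p * f p)"
      using p
      by (simp only: sum_transform_kernel_column greaterThanLessThan_iff)
        (simp add: transform_kernel_def mult_ac)
  qed
  finally show ?thesis
    by (simp add: transform_def)
qed

lemma transform_weight1_sum:
  assumes "0 < m" "m < n" and q: "\<And>j. 0 < j \<Longrightarrow> j < n \<Longrightarrow> q ^ j \<noteq> 1"
  shows "transform q n (\<lambda>p. weight1 q p * (\<Sum>i\<in>{0<..<Suc p}. f i)) m =
    weight1 q m * transform q n f m"
proof -
  let ?t = "\<lambda>p i. transform_kernel q m p * weight1 q p * f i"
  have "transform q n (\<lambda>p. weight1 q p * (\<Sum>i\<in>{0<..<Suc p}. f i)) m =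
      (\<Sum>p\<in>{0<..<n}. \<Sum>i\<in>{i\<in>{0<..<n}. i \<le> p}. ?t p i)"
    unfolding transform_def
  proof (intro sum.cong refl)
    fix p
    assume "p \<in> {0<..<n}"
    then have "{i\<in>{0<..<n}. i \<le> p} = {0<..<Suc p}"
      by auto
    then show "transform_kernel q m p * (weight1 q p * (\<Sum>i\<in>{0<..<Suc p}. f i)) =
        (\<Sum>i\<in>{i\<in>{0<..<n}. i \<le> p}. ?t p i)"
      by (simp add: sum_distrib_left mult_ac)
  qed
  also have "\<dots> = (\<Sum>i\<in>{0<..<n}. \<Sum>p\<in>{p\<in>{0<..<n}. i \<le> p}. ?t p i)"
    by (rule sum.swap_restrict) auto
  also have "\<dots> = (\<Sum>i\<in>{0<..<n}. weight1 q m * transform_kernel q m i * f i)"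
  proof (intro sum.cong refl)
    fix i
    assume i: "i \<in> {0<..<n}"
    then have "{p\<in>{0<..<n}. i \<le> p} = {i..<n}"
      by auto
    then show "(\<Sum>p\<in>{p\<in>{0<..<n}. i \<le> p}. ?t p i) = weight1 q m * transform_kernel q m i * f i"
      using sum_transform_kernel_row[of i n m q] i assms by (simp add: sum_distrib_right[symmetric])
  qed
  finally show ?thesis
    by (simp add: transform_def sum_distrib_left mult_ac)
qed

text \<open>
  The full row sum of \<open>K\<close> against \<open>weight1\<close> is the first entry of the row, times \<open>weight1\<close>:
  this is the empty word. Longer words follow by the two intertwining rules.
\<close>

lemma transform_word_fun:
  assumes "0 < m" "m < n" and q: "\<And>j. 0 < j \<Longrightarrow> j < n \<Longrightarrow> q ^ j \<noteq> 1"
  shows "transform q n (word_fun (weight0 q) (weight1 q) w) m =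
    - word_fun (weight1 q) (weight0 q) (tau w) m"
  using assms(1,2)
proof (induction w arbitrary: m)
  case Nil
  have "transform q n (weight1 q) m = (\<Sum>p=1..<n. transform_kernel q m p * weight1 q p)"
    unfolding transform_def by (intro sum.cong) auto
  also have "\<dots> = weight1 q m * transform_kernel q m 1"
    using Nil q by (intro sum_transform_kernel_row) auto
  finally show ?case
    by (simp add: tau_def transform_kernel_def weight0_def[of q m] weight1_def[of q m])
next
  case (Cons e w)
  show ?case
  proof (cases e)
    case E0
    have "transform q n (word_fun (weight0 q) (weight1 q) (e # w)) m =
        transform q n (\<lambda>p. weight0 q p * word_fun (weight0 q) (weight1 q) w p) m"
      by (simp add: transform_def E0)
    also have "\<dots> = weight0 q m *
        (\<Sum>i\<in>{0<..<Suc m}. transform q n (word_fun (weight0 q) (weight1 q) w) i)"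
      using Cons.prems q by (rule transform_mult_weight0)
    also have "\<dots> = weight0 q m *
        (\<Sum>i\<in>{0<..<Suc m}. - word_fun (weight1 q) (weight0 q) (tau w) i)"
      using Cons.prems by (intro arg_cong2[where f = "(*)"] sum.cong refl Cons.IH) auto
    finally show ?thesis
      by (simp add: E0 tau_def sum_negf transform_def)
  next
    case E1
    have "transform q n (word_fun (weight0 q) (weight1 q) (e # w)) m =
        transform q n (\<lambda>p. weight1 q p *
          (\<Sum>i\<in>{0<..<Suc p}. word_fun (weight0 q) (weight1 q) w i)) m"
      by (simp add: transform_def E1)
    also have "\<dots> = weight1 q m * transform q n (word_fun (weight0 q) (weight1 q) w) m"
      using Cons.prems q by (rule transform_weight1_sum)
    finally show ?thesis
      using Cons.IH[OF Cons.prems] by (simp add: E1 tau_def transform_def)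
  qed
qed

section \<open>Roots of unity\<close>

text \<open>
  Absorption gives \<open>gauss_binomial q n p = 0\<close> for \<open>0 < p < n\<close>; by the first Pascal rule,
  neighbouring Gaussian binomials with upper index \<open>n - 1\<close> then differ by a factor \<open>- (q ^ p)\<close>.
\<close>

lemma gauss_binomial_root:
  assumes "primitive_root_of_unity n q" "p < n"
  shows "q ^ p * signed_power q p * gauss_binomial q (n - 1) p = 1"
  using assms(2)
proof (induction p)
  case 0
  then show ?case by simp
next
  case (Suc p)
  obtain N where N: "n = Suc N"
    using Suc.prems by (cases n) auto
  have "q ^ Suc p \<noteq> 1" "q ^ Suc N = 1"
    using assms(1) Suc.prems N unfolding primitive_root_of_unity_def by blast+
  with gauss_binomial_absorb[of q p N] have "gauss_binomial q (Suc N) (Suc p) = 0"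
    by (simp del: gauss_binomial.simps power_Suc)
  then have "q ^ Suc p * gauss_binomial q N (Suc p) = - gauss_binomial q N p"
    by (simp add: add_eq_0_iff)
  then have "- (q ^ p) * signed_power q p * (q ^ Suc p * gauss_binomial q N (Suc p)) =
      q ^ p * signed_power q p * gauss_binomial q N p"
    by simp
  then have "q ^ Suc p * signed_power q (Suc p) * gauss_binomial q N (Suc p) =
      q ^ p * signed_power q p * gauss_binomial q N p"
    by (simp only: signed_power_simps mult_ac)
  then show ?case
    using Suc N by (simp del: signed_power_simps power_Suc)
qed

lemma sum_transform_kernel_root:
  assumes "primitive_root_of_unity n q" "0 < p" "p < n"
  shows "(\<Sum>m\<in>{0<..<n}. transform_kernel q m p) = 1"
  using sum_transform_kernel_column[of p q "n - 1"] gauss_binomial_root[OF assms(1,3)] assms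
  by simp

lemma sum_word_fun_tau:
  assumes "primitive_root_of_unity n q"
  shows "(\<Sum>m\<in>{0<..<n}. word_fun (weight0 q) (weight1 q) w m) =
    - (\<Sum>m\<in>{0<..<n}. word_fun (weight1 q) (weight0 q) (tau w) m)"
proof -
  let ?f = "word_fun (weight0 q) (weight1 q) w"
  have q: "q ^ j \<noteq> 1" if "0 < j" "j < n" for j
    using assms that by (simp add: primitive_root_of_unity_def)
  have "(\<Sum>m\<in>{0<..<n}. transform q n ?f m) =
      (\<Sum>p\<in>{0<..<n}. (\<Sum>m\<in>{0<..<n}. transform_kernel q m p) * ?f p)"
    unfolding transform_def sum_distrib_right by (rule sum.swap)
  also have "\<dots> = (\<Sum>p\<in>{0<..<n}. ?f p)"
    using assms by (intro sum.cong) (auto simp: sum_transform_kernel_root)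
  finally show ?thesis
    using q by (simp add: transform_word_fun sum_negf)
qed

lemma star_sum_reflect_weights:
  assumes "q ^ n = 1" "is_index ls"
  shows "star_sum n (map (\<lambda>k m. weight0 q m ^ (k - 1) * weight1 q m) (rev ls)) =
    (-1) ^ wt ls * star_sum n (map (\<lambda>k m. weight1 q m ^ (k - 1) * weight0 q m) ls)"
proof -
  have sign: "(- x) ^ (k - 1) * (- y) = (-1) ^ k * (x ^ (k - 1) * y)" if "k \<ge> 1"
    for x y :: complex and k
    using that by (cases k) (simp_all add: power_minus[of x])
  have "star_sum n (map (\<lambda>k m. weight0 q m ^ (k - 1) * weight1 q m) (rev ls)) =
      star_sum n (map (\<lambda>k m. weight0 q (n - m) ^ (k - 1) * weight1 q (n - m)) ls)"
    by (subst star_sum_reflect) (simp add: rev_map o_def)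
  also have "\<dots> =
      star_sum n (map (\<lambda>k m. (-1) ^ k * (weight1 q m ^ (k - 1) * weight0 q m)) ls)"
    using assms
    by (intro star_sum_cong)
      (auto simp: list_all2_conv_all_nth is_index_def weight_reflect sign
        simp del: One_nat_def mult_minus_right)
  finally show ?thesis
    by (simp add: star_sum_scale)
qed

section \<open>Duality\<close>

theorem theorem1p3:
  fixes ks :: "nat list" and n :: nat and \<zeta> :: complex
  assumes "ks \<noteq> []" and "is_index ks"
    and "n \<ge> 1" and "primitive_root_of_unity n \<zeta>"
  shows "z_star n ks \<zeta> = (-1) ^ (wt ks + 1) * z_star n (rev (hoffman_dual ks)) \<zeta>"
proof -
  let ?a = "weight0 \<zeta>" and ?b = "weight1 \<zeta>" and ?ls = "hoffman_dual ks"
  obtain w where w: "index_word ks = w @ [E1]" "index_word ?ls = tau w @ [E1]"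
    and ls: "is_index ?ls"
    using hoffman_dual_exists[OF assms(1)] by blast
  have ls_ne: "?ls \<noteq> []"
    using w(2) by auto
  have wt: "wt ?ls = wt ks"
    using length_index_word[OF assms(2)] length_index_word[OF ls] w by (simp add: tau_def)
  have root: "\<zeta> ^ n = 1"
    using assms(4) by (simp add: primitive_root_of_unity_def)
  have "is_index (rev ?ls)"
    using ls by (simp add: is_index_def)
  then have "z_star n (rev ?ls) \<zeta> = (1 - \<zeta>) ^ wt ks *
      star_sum n (map (\<lambda>k m. ?a m ^ (k - 1) * ?b m) (rev ?ls))"
    by (simp add: z_star_eq_star_sum wt rev_map)
  also have "\<dots> = (1 - \<zeta>) ^ wt ks * ((-1) ^ wt ks *
      (\<Sum>m\<in>{0<..<n}. word_fun ?b ?a (tau w) m))"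
    by (simp only: star_sum_reflect_weights[OF root ls] star_sum_index_word[OF ls_ne w(2)] wt)
  finally have dual: "z_star n (rev ?ls) \<zeta> = \<dots>" .
  have "z_star n ks \<zeta> = (1 - \<zeta>) ^ wt ks * (\<Sum>m\<in>{0<..<n}. word_fun ?a ?b w m)"
    by (simp only: z_star_eq_star_sum[OF assms(2)] star_sum_index_word[OF assms(1) w(1)])
  also have "\<dots> = (1 - \<zeta>) ^ wt ks * - (\<Sum>m\<in>{0<..<n}. word_fun ?b ?a (tau w) m)"
    by (simp only: sum_word_fun_tau[OF assms(4)])
  finally show ?thesis
    unfolding dual by (simp add: mult.left_commute power_mult_distrib[symmetric])
qed

end
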